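(* Let $\mathbb{F}_q$ be the finite field with $q$ elements, let $m$ be a positive integer, and let $r\in\mathbb{F}_q^{\times}$. Suppose that $\mathbb{F}_q$ contains a primitive $m$-th root of unity. Let $t=\mathrm{ord}_{\mathrm{ord}(r)\,m}(q)$, i.e. $t$ is the smallest positive integer such that $\mathrm{ord}(r)\,m \mid q^t-1$. Then $x^m-r$ factors over $\mathbb{F}_q$ into a product of $\frac{m}{t}$ irreducible polynomials of degree $t$.
   Context: For $r\in\mathbb{F}_q^{\times}$, $\mathrm{ord}(r)$ denotes the multiplicative order of $r$, i.e. the smallest positive integer $h$ such that $r^h=1$. For relatively prime integers $a,b$, $\mathrm{ord}_b(a)$ denotes the smallest positive integer $h$ such that $a^h\equiv 1 \pmod b$. A primitive $m$-th root of unity in $\mathbb{F}_q$ is an element of $\mathbb{F}_q^{\times}$ of multiplicative order exactly $m$. *)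

theory Defs
  imports
    "HOL-Number_Theory.Number_Theory"
    "HOL-Computational_Algebra.Computational_Algebra"
begin

text \<open>
  The library constant \<open>ord n a\<close> is the multiplicative order of \<open>a\<close> modulo \<open>n\<close>, for
  natural numbers and integers only. The order of an element of a field is meaningful below only
  for elements having some positive power equal to \<open>1\<close>; in a finite field these are exactly the
  nonzero elements.
\<close>

definition mult_ord :: "'a::field \<Rightarrow> nat" where
  "mult_ord x = (LEAST h. h > 0 \<and> x ^ h = 1)"

definition primitive_root_of_unity :: "nat \<Rightarrow> 'a::field \<Rightarrow> bool" where
  "primitive_root_of_unity m z \<longleftrightarrow> z \<noteq> 0 \<and> mult_ord z = m"

end

theory Submission
  imports Defs
begin

text \<open>
  Put \<open>\<omega> = r ^ ((q - 1) div m)\<close>. Modulo an irreducible factor \<open>p\<close> of \<open>x ^ m - r\<close> one has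
  \<open>x ^ q = \<omega> * x\<close>, so the Frobenius map multiplies a root of \<open>p\<close> by \<open>\<omega>\<close>, and the degree of \<open>p\<close>
  is the length of the Frobenius orbit, i.e. the order of \<open>\<omega>\<close>, which equals \<open>t\<close>.
  To avoid extension fields, this is carried out with congruences modulo \<open>p\<close>:
  \<open>p (\<omega> x)\<close> is congruent to \<open>p (x ^ q) = p (x) ^ q\<close>, hence divisible by \<open>p\<close>, and comparing
  coefficients gives \<open>\<omega> ^ degree p = 1\<close>; conversely \<open>(x ^ t) ^ q = x ^ t\<close> modulo \<open>p\<close>, so \<open>p\<close>
  divides \<open>x ^ t - c\<close> for some field element \<open>c\<close>.
\<close>

subsection \<open>Multiplicative order\<close>

lemma finite_field_power_card_minus_1:
  fixes x :: "'a::finite_field"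
  assumes "x \<noteq> 0"
  shows "x ^ (card (UNIV :: 'a set) - 1) = 1"
proof -
  have "x * x ^ (card (UNIV :: 'a set) - 1) = x ^ card (UNIV :: 'a set)"
    using finite_UNIV_card_ge_0[where ?'a = 'a] by (simp flip: power_Suc)
  then show ?thesis
    using assms by (simp add: finite_field_power_card_eq_same)
qed

lemma card_finite_field_gt_1: "card (UNIV :: 'a::finite_field set) > 1"
proof -
  have "card {0, 1 :: 'a} \<le> card (UNIV :: 'a set)"
    by (intro card_mono) auto
  then show ?thesis by simp
qed

lemma
  fixes x :: "'a::finite_field"
  assumes "x \<noteq> 0"
  shows mult_ord_pos: "mult_ord x > 0"
    and power_mult_ord: "x ^ mult_ord x = 1"
proof -
  have "mult_ord x > 0 \<and> x ^ mult_ord x = 1"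
    unfolding mult_ord_def
    by (rule LeastI[of _ "card (UNIV :: 'a set) - 1"])
      (use finite_field_power_card_minus_1[OF assms] card_finite_field_gt_1[where ?'a = 'a] in simp)
  then show "mult_ord x > 0" "x ^ mult_ord x = 1" by auto
qed

lemma power_eq_1_iff_mult_ord_dvd:
  fixes x :: "'a::finite_field"
  assumes "x \<noteq> 0"
  shows "x ^ n = 1 \<longleftrightarrow> mult_ord x dvd n"
proof
  assume "mult_ord x dvd n"
  then show "x ^ n = 1"
    by (auto simp: power_mult power_mult_ord[OF assms])
next
  assume n: "x ^ n = 1"
  let ?d = "mult_ord x"
  have "x ^ n = x ^ (?d * (n div ?d) + n mod ?d)" by simp
  also have "\<dots> = x ^ (n mod ?d)"
    unfolding power_add power_mult by (simp add: power_mult_ord[OF assms])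
  finally have "x ^ (n mod ?d) = 1" using n by simp
  moreover have "n mod ?d < (LEAST h. h > 0 \<and> x ^ h = 1)"
    using mult_ord_pos[OF assms] by (simp add: mult_ord_def)
  ultimately have "n mod ?d = 0"
    using not_less_Least[of "n mod ?d" "\<lambda>h. h > 0 \<and> x ^ h = 1"] by auto
  then show "?d dvd n" by auto
qed

text \<open>Factor \<open>q ^ i - 1 = m * k * (1 + q + ... + q ^ (i - 1))\<close>. The factor
  \<open>m\<close> cancels, and since \<open>q\<close> is 1 modulo \<open>d\<close>, the geometric
  sum reduces to \<open>i\<close> modulo \<open>d\<close>.\<close>

lemma ord_mult_dvd_iff:
  fixes m d k q i :: nat
  assumes "q = m * k + 1" and "m > 0" and "d dvd q - 1"
  shows "Pocklington.ord (d * m) q dvd i \<longleftrightarrow> d dvd k * i"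
proof -
  have geom: "int q ^ i - 1 = int m * (int k * (\<Sum>j<i. int q ^ j))"
    using power_diff_1_eq[of "int q" i] assms(1) by (simp add: algebra_simps)
  have q1: "[int q = 1] (mod int d)"
    using assms(1,3) by (simp add: cong_iff_dvd_diff flip: of_nat_mult)
  have "[(\<Sum>j<i. int q ^ j) = (\<Sum>j<i. 1 ^ j)] (mod int d)"
    by (intro cong_sum cong_pow q1)
  then have S: "[int k * (\<Sum>j<i. int q ^ j) = int k * int i] (mod int d)"
    by (intro cong_scalar_left) simp
  have "Pocklington.ord (d * m) q dvd i \<longleftrightarrow> [q ^ i = 1] (mod d * m)"
    by (simp add: ord_divides')
  also have "\<dots> \<longleftrightarrow> int (d * m) dvd int q ^ i - 1"
    by (simp add: cong_iff_dvd_diff flip: cong_int_iff)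
  also have "\<dots> \<longleftrightarrow> int d dvd int k * (\<Sum>j<i. int q ^ j)"
    using assms(2) unfolding geom by (simp add: mult.commute[of "int d"])
  also have "\<dots> \<longleftrightarrow> int d dvd int k * int i"
    using S by (meson cong_0_iff cong_sym cong_trans)
  finally show ?thesis by (simp flip: of_nat_mult)
qed

subsection \<open>Polynomials over a finite field\<close>

lemma pcompose_power: "pcompose (p ^ n) f = pcompose p f ^ n"
  for p f :: "'a::comm_semiring_1 poly"
  by (induction n) (simp_all add: pcompose_1 pcompose_mult)

lemma diff_dvd_pcompose_diff: "f - g dvd pcompose p f - pcompose p g"
  for p f g :: "'a::comm_ring_1 poly"
proof (induction p)
  case (pCons a p)
  have "pcompose (pCons a p) f - pcompose (pCons a p) g
      = f * (pcompose p f - pcompose p g) + (f - g) * pcompose p g"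
    by (simp add: pcompose_pCons algebra_simps)
  then show ?case using pCons by simp
qed simp

lemma monom_eq_power: "monom 1 n = [:0, 1:] ^ n"
  for n :: nat
  by (simp add: monom_altdef)

text \<open>Both sides are monic of degree \<open>q\<close>, so their difference has degree below
  \<open>q\<close>, yet it vanishes at all \<open>q\<close> field elements.\<close>

lemma linear_power_card:
  fixes a :: "'a::finite_field"
  shows "[:a, 1:] ^ card (UNIV :: 'a set) = [:a:] + [:0, 1:] ^ card (UNIV :: 'a set)"
    (is "?l = ?r")
proof (rule poly_eqI_degree_lead_coeff)
  let ?q = "card (UNIV :: 'a set)"
  have q: "?q > 0" by (simp add: finite_UNIV_card_ge_0)
  show "poly.coeff ?l ?q = poly.coeff ?r ?q"
    using q coeff_linear_power[of a ?q] by (simp add: coeff_pCons' flip: monom_eq_power)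
  show "degree ?l \<le> ?q" by (simp add: degree_linear_power)
  show "degree ?r \<le> ?q"
    by (intro degree_add_le) (simp_all add: degree_linear_power)
  show "poly ?l z = poly ?r z" if "z \<in> UNIV" for z
    by (simp add: finite_field_power_card_eq_same)
qed simp

text \<open>Coefficients are fixed by the \<open>q\<close>-th power, which is additive on
  polynomials. Additivity enters only through the linear case.\<close>

lemma power_card_eq_pcompose:
  fixes p :: "'a::finite_field poly"
  shows "p ^ card (UNIV :: 'a set) = pcompose p ([:0, 1:] ^ card (UNIV :: 'a set))"
proof (induction p)
  case 0
  then show ?case by (simp add: finite_UNIV_card_ge_0)
next
  case (pCons a p)
  let ?q = "card (UNIV :: 'a set)"
  \<comment> \<open>\<open>pCons a p\<close> is \<open>a + X * p\<close>, that is,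
    \<open>[:a, 1:]\<close> composed with \<open>X * p\<close>; so the linear identity can be
    substituted.\<close>
  have "pCons a p ^ ?q = pcompose ([:a, 1:] ^ ?q) ([:0, 1:] * p)"
    by (simp add: pcompose_power pcompose_pCons)
  also have "\<dots> = [:a:] + ([:0, 1:] * p) ^ ?q"
    unfolding linear_power_card[of a] by (simp add: pcompose_add pcompose_power pcompose_pCons)
  also have "\<dots> = [:a:] + [:0, 1:] ^ ?q * pcompose p ([:0, 1:] ^ ?q)"
    by (simp only: power_mult_distrib pCons.IH)
  finally show ?case by (simp add: pcompose_pCons)
qed

lemma prod_linear_factors_finite_field:
  "(\<Prod>c\<in>(UNIV :: 'a::finite_field set). [:- c, 1:])
    = [:0, 1:] ^ card (UNIV :: 'a set) - [:0, 1:]" (is "?l = ?r")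
proof (rule poly_eqI_degree_lead_coeff)
  let ?q = "card (UNIV :: 'a set)"
  have q: "?q > 1" by (rule card_finite_field_gt_1)
  have deg: "degree ?l = ?q" by (subst degree_prod_eq_sum_degree) auto
  have "lead_coeff ?l = 1" unfolding lead_coeff_prod by simp
  then show "poly.coeff ?l ?q = poly.coeff ?r ?q"
    using q by (simp add: deg coeff_pCons' flip: monom_eq_power)
  show "degree ?l \<le> ?q" by (simp add: deg)
  show "degree ?r \<le> ?q"
    using q by (intro degree_diff_le) (simp_all add: degree_linear_power)
  show "poly ?l z = poly ?r z" if "z \<in> UNIV" for z
    by (auto simp: poly_prod finite_field_power_card_eq_same intro!: prod_zero)
qed simp

text \<open>Substituting \<open>f\<close> into the splitting of \<open>X ^ q - X\<close> writes
  \<open>f ^ q - f\<close> as the product of all \<open>f - c\<close>; a prime divisor must divide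
  one factor. Thus Frobenius-fixed residues modulo \<open>p\<close> are constants.\<close>

lemma prime_elem_dvd_power_card_minus:
  fixes p f :: "'a::finite_field poly"
  assumes "prime_elem p" and "p dvd f ^ card (UNIV :: 'a set) - f"
  obtains c where "p dvd f - [:c:]"
proof -
  have "f ^ card (UNIV :: 'a set) - f
      = pcompose (\<Prod>c\<in>(UNIV :: 'a set). [:- c, 1:]) f"
    unfolding prod_linear_factors_finite_field
    by (simp add: pcompose_diff pcompose_power pcompose_pCons)
  also have "\<dots> = (\<Prod>c\<in>UNIV. f - [:c:])"
    by (simp add: pcompose_prod pcompose_pCons diff_conv_add_uminus add.commute del: add_uminus_conv_diff)
  finally have "p dvd (\<Prod>c\<in>UNIV. f - [:c:])" using assms(2) by simp
  then show ?thesis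
    using prime_elem_dvd_prod_msetE[OF assms(1), of "image_mset (\<lambda>c. f - [:c:]) (mset_set UNIV)"]
      that by (auto simp: prod_unfold_prod_mset)
qed

text \<open>Scaling the variable preserves the degree, so the cofactor is constant; the nonzero
  constant term, unchanged by scaling, forces it to be 1. Leading coefficients then give the
  claim.\<close>

lemma dvd_pcompose_scale_imp_power_eq_1:
  fixes p :: "'a::field poly"
  assumes "p dvd pcompose p [:0, w:]" and "poly p 0 \<noteq> 0" and "w \<noteq> 0"
  shows "w ^ degree p = 1"
proof -
  obtain h where h: "pcompose p [:0, w:] = p * h" using assms(1) by blast
  have "p \<noteq> 0" using assms(2) by auto
  have deg: "degree (pcompose p [:0, w:]) = degree p"
    using assms(3) by (simp add: degree_pcompose)
  have "h \<noteq> 0"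
    using h \<open>p \<noteq> 0\<close> assms(2) by (metis coeff_pCons_0 coeff_pcompose_0 coeff_0 mult_zero_right)
  then have "degree h = 0"
    using deg \<open>p \<noteq> 0\<close> unfolding h by (simp add: degree_mult_eq)
  then obtain c where c: "h = [:c:]" by (rule degree_eq_zeroE)
  have "poly.coeff (pcompose p [:0, w:]) 0 = poly p 0" by simp
  then have "c = 1"
    unfolding h c using assms(2) by (simp add: poly_0_coeff_0)
  then have "lead_coeff (pcompose p [:0, w:]) = lead_coeff p"
    unfolding h c by simp
  moreover have "lead_coeff (pcompose p [:0, w:]) = lead_coeff p * w ^ degree p"
    using assms(3) by (subst lead_coeff_comp) auto
  ultimately show ?thesis using \<open>p \<noteq> 0\<close> by simp
qed

section \<open>Irreducible factorization and the degrees of the factors\<close>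

lemma field_poly_factorization:
  fixes f :: "'a::field poly"
  assumes "degree f > 0"
  shows "\<exists>P. (\<forall>p\<in>#P. irreducible p) \<and> f = prod_mset P"
  using assms
proof (induction "degree f" arbitrary: f rule: less_induct)
  case less
  have nz: "f \<noteq> 0" using less.prems by auto
  show ?case
  proof (cases "irreducible f")
    case True
    then show ?thesis by (intro exI[of _ "{#f#}"]) auto
  next
    case False
    then obtain a b where ab: "f = a * b" "\<not> is_unit a" "\<not> is_unit b"
      using less.prems nz by (auto simp: irreducible_def is_unit_iff_degree)
    then have "a \<noteq> 0" "b \<noteq> 0" using nz by auto
    then have "degree a > 0" "degree b > 0" "degree f = degree a + degree b"
      using ab by (auto simp: is_unit_iff_degree degree_mult_eq)
    then obtain A B where "\<forall>p\<in>#A. irreducible p" "a = prod_mset A"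
        "\<forall>p\<in>#B. irreducible p" "b = prod_mset B"
      using less.hyps[of a] less.hyps[of b] by auto
    then show ?thesis using ab(1) by (intro exI[of _ "A + B"]) auto
  qed
qed

lemma degree_prod_mset_const:
  fixes P :: "'a::field poly multiset"
  assumes "\<forall>p\<in>#P. p \<noteq> 0 \<and> degree p = t"
  shows "degree (prod_mset P) = size P * t"
  using assms
proof (induction P)
  case (add p P)
  moreover have "prod_mset P \<noteq> 0" using add.prems by (auto simp: prod_mset_zero_iff)
  ultimately show ?case by (auto simp: degree_mult_eq)
qed simp

lemma degree_binomial:
  fixes c :: "'a::field"
  assumes "n > 0"
  shows "degree ([:0, 1:] ^ n - [:c:]) = n"
  using degree_add_eq_left[of "[:- c:]" "[:0, 1:] ^ n"] assms
  by (simp add: degree_linear_power diff_conv_add_uminus del: add_uminus_conv_diff)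

text \<open>The hypotheses on \<open>t\<close> say that it is the order of \<open>r ^ k\<close>. The
  scaling congruence yields \<open>t \<le> degree p\<close>, a binomial divisible by
  \<open>p\<close> the reverse.\<close>

lemma degree_irreducible_dvd_binomial:
  fixes r :: "'a::finite_field" and p :: "'a poly"
  assumes k: "card (UNIV :: 'a set) = m * k + 1"
    and "r \<noteq> 0"
    and t: "t > 0" "\<And>i. (r ^ k) ^ i = 1 \<longleftrightarrow> t dvd i"
    and "irreducible p" and p_dvd: "p dvd [:0, 1:] ^ m - [:r:]"
  shows "degree p = t"
proof -
  let ?q = "card (UNIV :: 'a set)" and ?w = "r ^ k" and ?X = "[:0, 1:] :: 'a poly"
  have prime: "prime_elem p"
    using \<open>irreducible p\<close> by (rule field_poly_irreducible_imp_prime)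
  have "m > 0" using k card_finite_field_gt_1[where ?'a = 'a] by (cases m) auto
  \<comment> \<open>Raise \<open>X ^ m = r\<close> to the power \<open>k\<close> modulo
    \<open>p\<close> and multiply by \<open>X\<close>: as \<open>q = m * k + 1\<close>, this is
    \<open>X ^ q = w * X\<close>.\<close>
  have "?X ^ m - [:r:] dvd (?X ^ m) ^ k - [:r:] ^ k"
    unfolding power_diff_sumr2 by simp
  then have "p dvd ?X * ((?X ^ m) ^ k - [:r:] ^ k)"
    using p_dvd by (meson dvd_trans dvd_mult)
  also have "\<dots> = ?X ^ ?q - [:0, ?w:]"
    by (simp add: k poly_const_pow algebra_simps flip: power_mult)
  finally have frob: "p dvd ?X ^ ?q - [:0, ?w:]" .

  have "p dvd pcompose p (?X ^ ?q) - pcompose p [:0, ?w:]"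
    using frob diff_dvd_pcompose_diff by (rule dvd_trans)
  moreover have "p dvd pcompose p (?X ^ ?q)"
    using finite_UNIV_card_ge_0[where ?'a = 'a]
    by (simp add: dvd_power flip: power_card_eq_pcompose)
  ultimately have "p dvd pcompose p [:0, ?w:]"
    by (metis dvd_diff diff_diff_eq2 add_diff_cancel_left')
  moreover have "poly p 0 \<noteq> 0"
  proof
    assume "poly p 0 = 0"
    then have "poly (?X ^ m - [:r:]) 0 = 0"
      using p_dvd by (metis dvd_def mult_zero_left poly_mult)
    then show False using \<open>m > 0\<close> \<open>r \<noteq> 0\<close> by (simp add: power_0_left)
  qed
  ultimately have "?w ^ degree p = 1"
    using \<open>r \<noteq> 0\<close> by (intro dvd_pcompose_scale_imp_power_eq_1) auto
  then have "t dvd degree p" using t(2) by simp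
  moreover have "degree p > 0"
    using \<open>irreducible p\<close> by (metis is_unit_iff_degree irreducible_def gr0I)
  ultimately have ge: "t \<le> degree p" by (simp add: dvd_imp_le)

  \<comment> \<open>Since \<open>w ^ t = 1\<close>, the \<open>t\<close>-th power of the Frobenius
    congruence shows that \<open>X ^ t\<close> is fixed by Frobenius modulo
    \<open>p\<close>.\<close>
  have "[:0, ?w:] ^ t = smult (?w ^ t) (?X ^ t)"
    by (simp flip: smult_power)
  then have "[:0, ?w:] ^ t = ?X ^ t" using t(2)[of t] by simp
  moreover have "(?X ^ ?q) ^ t = (?X ^ t) ^ ?q"
    by (simp add: mult.commute flip: power_mult)
  moreover have "p dvd (?X ^ ?q) ^ t - [:0, ?w:] ^ t"
    unfolding power_diff_sumr2 using frob by (rule dvd_mult2)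
  ultimately have "p dvd (?X ^ t) ^ ?q - ?X ^ t" by simp
  then obtain c where c: "p dvd ?X ^ t - [:c:]"
    by (rule prime_elem_dvd_power_card_minus[OF prime])
  have deg: "degree (?X ^ t - [:c:]) = t"
    using t(1) by (rule degree_binomial)
  then have "degree p \<le> t"
    using dvd_imp_degree_le[OF c] t(1) by force
  then show ?thesis using ge by simp
qed

theorem theorem7:
  fixes r :: "'a::finite_field" and m q t :: nat
  assumes "q = card (UNIV :: 'a set)"
    and "m > 0"
    and "r \<noteq> 0"
    and "\<exists>z::'a. primitive_root_of_unity m z"
    and "t = Pocklington.ord (mult_ord r * m) q"
  shows "t dvd m \<and>
    (\<exists>P :: 'a poly multiset.
      size P = m div t \<and>
      (\<forall>p \<in># P. Factorial_Ring.irreducible p \<and> Polynomial.degree p = t) \<and>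
      Polynomial.monom 1 m - [:r:] = prod_mset P)"
proof -
  have ord_dvd: "mult_ord x dvd q - 1" if "x \<noteq> 0" for x :: 'a
    using that finite_field_power_card_minus_1[OF that] assms(1)
    by (simp flip: power_eq_1_iff_mult_ord_dvd)
  have "q > 1" using assms(1) card_finite_field_gt_1[where ?'a = 'a] by simp
  obtain z :: 'a where "z \<noteq> 0" "mult_ord z = m"
    using assms(4) by (auto simp: primitive_root_of_unity_def)
  then obtain k where "q - 1 = m * k" using ord_dvd[of z] by (auto elim!: dvdE)
  then have k: "q = m * k + 1" using \<open>q > 1\<close> by simp
  \<comment> \<open>Both sides amount to \<open>mult_ord r dvd k * i\<close>.\<close>
  have w: "(r ^ k) ^ i = 1 \<longleftrightarrow> t dvd i" for i
    using ord_mult_dvd_iff[OF k assms(2) ord_dvd[OF assms(3)], of i]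
    by (simp add: assms(5) power_eq_1_iff_mult_ord_dvd[OF assms(3)] flip: power_mult)
  have "(r ^ k) ^ m = 1"
    using finite_field_power_card_minus_1[OF assms(3)] k assms(1)
    by (simp add: mult.commute flip: power_mult)
  then have "t dvd m" using w by simp
  then have "t > 0" using assms(2) by (auto intro: gr0I)
  have deg: "degree ([:0, 1:] ^ m - [:r:]) = m"
    using assms(2) by (rule degree_binomial)
  then obtain P where P: "\<forall>p\<in>#P. irreducible p" "[:0, 1:] ^ m - [:r:] = prod_mset P"
    using field_poly_factorization[of "[:0, 1:] ^ m - [:r:]"] assms(2) by auto
  have degP: "degree p = t" if "p \<in># P" for p
    by (rule degree_irreducible_dvd_binomial[of m k r])
      (use that P k assms(1,3) w \<open>t > 0\<close> in \<open>auto intro: dvd_prod_mset\<close>)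
  \<comment> \<open>Compare degrees on both sides of the factorization.\<close>
  have "m = size P * t"
    using degree_prod_mset_const[of P t] P degP deg by (auto simp: irreducible_def)
  then have "size P = m div t" using \<open>t > 0\<close> by simp
  then show ?thesis
    using \<open>t dvd m\<close> P degP by (intro conjI exI[of _ P]) (auto simp: monom_eq_power)
qed

end
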